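(* For every word $w$ of length $n \ge 1$ over a finite alphabet, $$\sum_{r\in \mathrm{MR}(w)}\bigl(e(r)-1\bigr)\le n\ln(n).$$
   Context: For a nonempty word $u$, its (minimal) period $\pi(u)$ is the least positive integer $p$ such that $u[i]=u[i+p]$ whenever positions $i$ and $i+p$ both exist in $u$; its exponent is $e(u)=|u|/\pi(u)$. For a word $w$ of length $n$, a maximal repetition in $w$ is an occurrence $w[i..j]$ ($1\le i\le j\le n$, distinct occurrences counted separately, i.e. identified by the pair $(i,j)$) such that $\pi(w[i..j])>\pi(w[i-1..j])$ whenever $i\neq 1$, and $\pi(w[i..j])>\pi(w[i..j+1])$ whenever $j\neq n$. $\mathrm{MR}(w)$ denotes the set of maximal repetitions in $w$ whose exponent is strictly greater than $1$. $\ln$ is the natural logarithm. *)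

theory Defs
  imports Complex_Main
begin

(* Positions are 1-based, as in w[i..j]; list indices are 0-based. *)
definition factor :: "'a list \<Rightarrow> nat \<Rightarrow> nat \<Rightarrow> 'a list" where
  "factor w i j = drop (i - 1) (take j w)"

lemma length_factor: "1 \<le> i \<Longrightarrow> i \<le> j \<Longrightarrow> j \<le> length w \<Longrightarrow> length (factor w i j) = Suc j - i"
  by (simp add: factor_def)

lemma nth_factor:
  "1 \<le> i \<Longrightarrow> i \<le> j \<Longrightarrow> j \<le> length w \<Longrightarrow> k < Suc j - i \<Longrightarrow> factor w i j ! k = w ! (i - 1 + k)"
  by (simp add: factor_def)

definition period :: "'a list \<Rightarrow> nat" where
  "period u = (LEAST p. 0 < p \<and> (\<forall>i. i + p < length u \<longrightarrow> u ! i = u ! (i + p)))"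

definition exponent :: "'a list \<Rightarrow> real" where
  "exponent u = real (length u) / real (period u)"

(* Maximality: extending the occurrence by one letter on either side, where
   possible, strictly increases the minimal period. (With the two inequalities
   reversed, the whole word would be the only maximal repetition, as the period
   of a factor never exceeds that of the word.) *)
definition maximal_repetition :: "'a list \<Rightarrow> nat \<Rightarrow> nat \<Rightarrow> bool" where
  "maximal_repetition w i j \<longleftrightarrow>
     1 \<le> i \<and> i \<le> j \<and> j \<le> length w \<and>
     (i \<noteq> 1 \<longrightarrow> period (factor w i j) < period (factor w (i - 1) j)) \<and>
     (j \<noteq> length w \<longrightarrow> period (factor w i j) < period (factor w i (j + 1)))"

definition MR :: "'a list \<Rightarrow> (nat \<times> nat) set" where
  "MR w = {(i, j). maximal_repetition w i j \<and> exponent (factor w i j) > 1}"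

lemma finite_MR: "finite (MR w)"
  by (rule finite_subset [of _ "{1..length w} \<times> {1..length w}"])
     (auto simp: MR_def maximal_repetition_def)

end

theory Submission
  imports Defs "HOL-Analysis.Harmonic_Numbers"
begin

text \<open>A repetition w[i..j] with period p contributes (j - i + 1 - p) / p, that is, weight 1 / p
  for every position k with i \<le> k \<le> j - p. Maximality makes the position sets of distinct maximal
  repetitions with the same period disjoint, so period p contributes at most (n - p) / p in total,
  and the sum of these bounds is n (harm n - 1) \<le> n ln n.\<close>

lemma period_props:
  assumes "u \<noteq> []"
  shows period_pos: "0 < period u"
    and period_nth: "\<And>i. i + period u < length u \<Longrightarrow> u ! i = u ! (i + period u)"
proof -
  have "0 < period u \<and> (\<forall>i. i + period u < length u \<longrightarrow> u ! i = u ! (i + period u))"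
    \<comment> \<open>The witness \<open>length u\<close> satisfies the matching condition vacuously
      and is positive because \<open>u\<close> is nonempty.\<close>
    unfolding period_def by (rule LeastI[of _ "length u"]) (use assms in auto)
  then show "0 < period u" "\<And>i. i + period u < length u \<Longrightarrow> u ! i = u ! (i + period u)"
    by auto
qed

lemma period_le:
  assumes "0 < p" "\<And>i. i + p < length u \<Longrightarrow> u ! i = u ! (i + p)"
  shows "period u \<le> p"
  unfolding period_def by (rule Least_le) (use assms in auto)

context
  fixes w :: "'a list" and i j :: nat
  assumes bounds: "1 \<le> i" "i \<le> j" "j \<le> length w"
begin

lemma factor_nonempty: "factor w i j \<noteq> []"
  using length_factor[OF bounds] bounds by fastforce

lemma factor_period_nth:
  assumes "i \<le> k" "k + period (factor w i j) \<le> j"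
  shows "w ! (k - 1) = w ! (k - 1 + period (factor w i j))"
proof -
  let ?p = "period (factor w i j)"
  have "factor w i j ! (k - i) = factor w i j ! (k - i + ?p)"
    using assms bounds by (intro period_nth factor_nonempty) (simp add: length_factor)
  then show ?thesis
    using assms bounds by (simp add: nth_factor)
qed

text \<open>Converse direction to \<open>factor_period_nth\<close>. An upper bound on the period
  suffices, since maximality is contradicted as soon as a one-letter extension has period at most
  \<open>p\<close>.\<close>

lemma period_factor_le:
  assumes "0 < p" "\<And>k. i \<le> k \<Longrightarrow> k + p \<le> j \<Longrightarrow> w ! (k - 1) = w ! (k - 1 + p)"
  shows "period (factor w i j) \<le> p"
proof (rule period_le)
  fix l assume l: "l + p < length (factor w i j)"
  then show "factor w i j ! l = factor w i j ! (l + p)"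
    using assms(2)[of "i + l"] bounds
    by (simp add: length_factor nth_factor add.assoc)
qed (fact assms(1))

end

text \<open>Each \<open>k\<close> is the 1-based left end of a matching pair \<open>k\<close>,
  \<open>k + p\<close>. Tagging it with the period \<open>p\<close> makes the sets for different
  periods disjoint automatically, and lets the weight \<open>1 / p\<close> be read off the
  element.\<close>

definition repeat_positions :: "'a list \<Rightarrow> nat \<Rightarrow> nat \<Rightarrow> (nat \<times> nat) set" where
  "repeat_positions w i j =
     {period (factor w i j)} \<times> {k. i \<le> k \<and> k + period (factor w i j) \<le> j}"

text \<open>A shared element forces equal periods \<open>p\<close> and glues the two occurrences
  into one \<open>p\<close>-periodic stretch. If the first stuck out of the second, the second could
  grow by a letter without increasing its period. Using this in both directions yields
  equality.\<close>

lemma repeat_positions_inter_le: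
  assumes mr: "maximal_repetition w i j" "maximal_repetition w i' j'"
    and x: "x \<in> repeat_positions w i j" "x \<in> repeat_positions w i' j'"
  shows "i' \<le> i" and "j \<le> j'"
proof -
  obtain p k where "x = (p, k)"
    by (cases x)
  then have p: "period (factor w i j) = p" and p': "period (factor w i' j') = p"
    and k: "i \<le> k" "k + p \<le> j" "i' \<le> k" "k + p \<le> j'"
    using x by (simp_all add: repeat_positions_def)
  have b: "1 \<le> i" "i \<le> j" "j \<le> length w" "1 \<le> i'" "i' \<le> j'" "j' \<le> length w"
    using mr by (auto simp: maximal_repetition_def)
  have p0: "0 < p"
    using period_pos[OF factor_nonempty[OF b(1-3)]] p by simp
  have eq: "w ! (l - 1) = w ! (l - 1 + p)" if "i \<le> l" "l + p \<le> j" for l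
    using factor_period_nth[OF b(1-3), of l] that p by simp
  have eq': "w ! (l - 1) = w ! (l - 1 + p)" if "i' \<le> l" "l + p \<le> j'" for l
    using factor_period_nth[OF b(4-6), of l] that p' by simp
  have eq_union: "w ! (l - 1) = w ! (l - 1 + p)" if "min i i' \<le> l" "l + p \<le> max j j'" for l
  proof -
    \<comment> \<open>Both ranges of left ends contain \<open>k\<close>, so their union has no gap:
      for \<open>l \<le> k\<close> the occurrence starting first covers \<open>l\<close>, for
      \<open>l \<ge> k\<close> the one ending last.\<close>
    have "i \<le> l \<and> l + p \<le> j \<or> i' \<le> l \<and> l + p \<le> j'"
      using that k by (simp add: min_def max_def split: if_splits) arith+
    then show ?thesis
      using eq eq' by blast
  qed
  show "i' \<le> i"
  proof (rule ccontr)
    assume "\<not> i' \<le> i"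
    then have "period (factor w (i' - 1) j') \<le> p"
      using b p0 by (intro period_factor_le eq_union) auto
    then show False
      using mr(2) p' \<open>\<not> i' \<le> i\<close> b by (simp add: maximal_repetition_def)
  qed
  show "j \<le> j'"
  proof (rule ccontr)
    assume "\<not> j \<le> j'"
    then have "period (factor w i' (j' + 1)) \<le> p"
      using b p0 by (intro period_factor_le eq_union) auto
    then show False
      using mr(2) p' \<open>\<not> j \<le> j'\<close> b by (simp add: maximal_repetition_def)
  qed
qed

lemma repeat_positions_disjoint:
  assumes "maximal_repetition w i j" "maximal_repetition w i' j'" "(i, j) \<noteq> (i', j')"
  shows "repeat_positions w i j \<inter> repeat_positions w i' j' = {}"
proof (rule ccontr)
  assume "\<not> ?thesis"
  then obtain x where "x \<in> repeat_positions w i j" "x \<in> repeat_positions w i' j'"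
    by blast
  then have "i = i'" "j = j'"
    using repeat_positions_inter_le[OF assms(1,2)] repeat_positions_inter_le[OF assms(2,1)]
    by (blast intro: antisym)+
  then show False
    using assms(3) by simp
qed

lemma finite_repeat_positions: "finite (repeat_positions w i j)"
proof -
  have "repeat_positions w i j \<subseteq> {period (factor w i j)} \<times> {..j}"
    by (auto simp: repeat_positions_def)
  then show ?thesis
    by (rule finite_subset) simp
qed

lemma exponent_minus_1_eq_sum:
  assumes "(i, j) \<in> MR w"
  shows "exponent (factor w i j) - 1 = (\<Sum>(p, k)\<in>repeat_positions w i j. 1 / real p)"
proof -
  define p where "p = period (factor w i j)"
  have b: "1 \<le> i" "i \<le> j" "j \<le> length w"
    using assms by (auto simp: MR_def maximal_repetition_def)
  have p0: "0 < p"
    unfolding p_def by (rule period_pos[OF factor_nonempty[OF b]])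
  have len: "length (factor w i j) = Suc j - i"
    by (rule length_factor[OF b])
  \<comment> \<open>Exponent above 1 is used here; it gives \<open>i \<le> j - p\<close>, so the
    natural-number subtractions below are not truncated.\<close>
  have p_lt: "p < Suc j - i"
    using assms p0 by (auto simp: MR_def exponent_def len p_def[symmetric] less_divide_eq)
  then have "{k. i \<le> k \<and> k + p \<le> j} = {i..j - p}"
    by auto
  then have "(\<Sum>(p, k)\<in>repeat_positions w i j. 1 / real p) = real (Suc (j - p) - i) / real p"
    by (simp add: repeat_positions_def p_def[symmetric] sum.cartesian_product[symmetric])
  also have "\<dots> = exponent (factor w i j) - 1"
    using p0 p_lt by (simp add: exponent_def len p_def[symmetric] field_simps)
  finally show ?thesis ..
qed

theorem theorem1:
  fixes A :: "'a set" and w :: "'a list" and n :: nat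
  assumes "finite A"
    and "set w \<subseteq> A"
    and "length w = n"
    and "n \<ge> 1"
  shows "(\<Sum>(i, j)\<in>MR w. exponent (factor w i j) - 1) \<le> real n * ln (real n)"
proof -
  \<comment> \<open>All conceivable matching pairs in a word of length \<open>n\<close>; the fibre
    over \<open>p = n\<close> is empty.\<close>
  let ?S = "SIGMA p:{1..n}. {1..n - p}"
  let ?R = "\<lambda>(i, j). repeat_positions w i j"
  have "(\<Sum>(i, j)\<in>MR w. exponent (factor w i j) - 1)
      = (\<Sum>r\<in>MR w. \<Sum>(p, k)\<in>?R r. 1 / real p)"
    by (intro sum.cong) (auto simp: exponent_minus_1_eq_sum)
  also have "\<dots> = (\<Sum>(p, k)\<in>(\<Union>r\<in>MR w. ?R r). 1 / real p)"
  proof (rule sum.UNION_disjoint[symmetric])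
    show "\<forall>r\<in>MR w. \<forall>s\<in>MR w. r \<noteq> s \<longrightarrow> ?R r \<inter> ?R s = {}"
    proof (intro ballI impI)
      fix r s assume "r \<in> MR w" "s \<in> MR w" "r \<noteq> s"
      then show "?R r \<inter> ?R s = {}"
        using repeat_positions_disjoint[of w "fst r" "snd r" "fst s" "snd s"]
        by (simp add: MR_def split_beta prod_eq_iff)
    qed
  qed (auto simp: finite_MR finite_repeat_positions)
  also have "\<dots> \<le> (\<Sum>(p, k)\<in>?S. 1 / real p)"
  proof (rule sum_mono2)
    show "(\<Union>r\<in>MR w. ?R r) \<subseteq> ?S"
    proof clarify
      fix i j p k assume r: "(i, j) \<in> MR w" and x: "(p, k) \<in> repeat_positions w i j"
      have b: "1 \<le> i" "i \<le> j" "j \<le> length w"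
        using r by (auto simp: MR_def maximal_repetition_def)
      have "0 < p" "i \<le> k" "k + p \<le> j"
        using x period_pos[OF factor_nonempty[OF b]] by (auto simp: repeat_positions_def)
      then show "p \<in> {1..n} \<and> k \<in> {1..n - p}"
        using b assms(3) by auto
    qed
  qed auto
  also have "\<dots> = (\<Sum>p=1..n. real (n - p) / real p)"
    by (simp add: sum.Sigma[symmetric])
  also have "\<dots> = (\<Sum>p=1..n. real n * inverse (real p) - 1)"
    by (intro sum.cong) (auto simp: field_simps)
  also have "\<dots> = real n * (harm n - 1)"
    by (simp add: harm_def sum_subtractf sum_distrib_left algebra_simps)
  also have "\<dots> \<le> real n * ln (real n)"
    \<comment> \<open>The sequence \<open>harm n - ln n\<close> is decreasing and equals 1 at
      \<open>n = 1\<close>, hence \<open>harm n - 1 \<le> ln n\<close>.\<close>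
    using euler_mascheroni_sequence_decreasing[of 1 n] assms(4)
    by (intro mult_left_mono) (auto simp: harm_expand)
  finally show ?thesis .
qed

end
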